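(* Let $m\ge 1$ be an integer and let $(x_k)_{k\ge 0}$ be generated by Anderson acceleration AA($m$) from an initial guess $x_0\in\mathbb{R}^n$, applied to the linear fixed-point function $q(x)=Mx+b$, with residuals $r_k=x_k-q(x_k)$. For $k\ge m$ let $R_k=[\,r_k-r_{k-1}\ \ r_k-r_{k-2}\ \cdots\ r_k-r_{k-m}\,]$. Then for all $k\ge m$: if $R_k^TR_k$ is invertible, then $$ r_{k+1}=M\big(I-R_k(R_k^TR_k)^{-1}R_k^T\big)r_k. $$ More generally, $$ r_{k+1}=M(I-R_kR_k^{\dagger})r_k,\qquad k\ge m. $$ Furthermore, $$ R_k^T(I-R_kR_k^{\dagger})r_k=0,\qquad k\ge m. $$
   Context: Setting: $M\in\mathbb{R}^{n\times n}$, $b\in\mathbb{R}^n$, $q(x)=Mx+b$, $A=I-M$ is nonsingular and $M\neq 0$. $\|\cdot\|$ is the 2-norm, and $\dagger$ denotes the Moore–Penrose pseudo-inverse. The residual is $r(x)=x-q(x)=Ax-b$ and $r_k=r(x_k)$. AA($m$) with finite window size $m$: given $x_0\in\mathbb{R}^n$, for $k=0,1,2,\ldots$, with $m_k=\min(k,m)$, $$x_{k+1}=q(x_k)+\sum_{i=1}^{m_k}\beta_i^{(k)}\big(q(x_k)-q(x_{k-i})\big)$$ (so $x_1=q(x_0)$). The coefficient vector $\boldsymbol\beta^{(k)}=(\beta_1^{(k)},\ldots,\beta_{m_k}^{(k)})^T$ is the minimum-norm minimizer of $\|r_k+\sum_{i=1}^{m_k}\beta_i(r_k-r_{k-i})\|^2$,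 i.e. $\boldsymbol\beta^{(k)}=-R_k^{\dagger}r_k$ with $R_k=[\,r_k-r_{k-1}\ \cdots\ r_k-r_{k-m_k}\,]$; it equals $-(R_k^TR_k)^{-1}R_k^Tr_k$ if $R_k^TR_k$ is invertible. *)

theory Defs
  imports Complex_Main "Jordan_Normal_Form.Gauss_Jordan_Elimination"
begin

definition norm2_vec :: "real vec \<Rightarrow> real" where
  "norm2_vec v = sqrt (v \<bullet> v)"

text \<open>
  The four Penrose conditions. Every real matrix has exactly one such \<open>X\<close>, so the definite
  description in \<open>pseudo_inverse\<close> is well defined.
\<close>

definition is_pseudo_inverse :: "real mat \<Rightarrow> real mat \<Rightarrow> bool" where
  "is_pseudo_inverse A X \<longleftrightarrow>
     X \<in> carrier_mat (dim_col A) (dim_row A) \<and>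
     A * X * A = A \<and> X * A * X = X \<and>
     transpose_mat (A * X) = A * X \<and> transpose_mat (X * A) = X * A"

definition pseudo_inverse :: "real mat \<Rightarrow> real mat" where
  "pseudo_inverse A = (THE X. is_pseudo_inverse A X)"

definition fp_map :: "real mat \<Rightarrow> real vec \<Rightarrow> real vec \<Rightarrow> real vec" where
  "fp_map M b x = M *\<^sub>v x + b"

definition residual :: "(real vec \<Rightarrow> real vec) \<Rightarrow> real vec \<Rightarrow> real vec" where
  "residual q x = x - q x"

text \<open>
  The correction \<open>\<Sum>i=1..p. \<beta>\<^sub>i (y k - y (k - i))\<close>, for a sequence \<open>y\<close> of
  vectors of dimension \<open>n\<close>. Vectors are indexed from 0, so the coefficient \<open>\<beta>\<^sub>i\<close>
  is stored at position \<open>i - 1\<close>.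
\<close>

definition aa_correction :: "nat \<Rightarrow> (nat \<Rightarrow> real vec) \<Rightarrow> nat \<Rightarrow> nat \<Rightarrow> real vec \<Rightarrow> real vec" where
  "aa_correction n y p k \<beta> =
     finsum_vec TYPE(real) n (\<lambda>i. \<beta> $ (i - 1) \<cdot>\<^sub>v (y k - y (k - i))) {1..p}"

definition is_min_norm_minimizer :: "nat \<Rightarrow> (real vec \<Rightarrow> real) \<Rightarrow> real vec \<Rightarrow> bool" where
  "is_min_norm_minimizer p f \<beta> \<longleftrightarrow>
     is_arg_min norm2_vec (is_arg_min f (\<lambda>\<gamma>. \<gamma> \<in> carrier_vec p)) \<beta>"

text \<open>
  \<open>anderson n m q x\<close> says that the sequence \<open>x\<close> is generated by AA(\<open>m\<close>) from \<open>x 0\<close>.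
  For \<open>k = 0\<close> the coefficient vector is empty, so \<open>x 1 = q (x 0)\<close>.
\<close>

definition anderson :: "nat \<Rightarrow> nat \<Rightarrow> (real vec \<Rightarrow> real vec) \<Rightarrow> (nat \<Rightarrow> real vec) \<Rightarrow> bool" where
  "anderson n m q x \<longleftrightarrow>
     x 0 \<in> carrier_vec n \<and>
     (\<forall>k. let p = min k m; r = (\<lambda>j. residual q (x j)) in
        \<exists>\<beta>. is_min_norm_minimizer p
               (\<lambda>\<gamma>. (norm2_vec (r k + aa_correction n r p k \<gamma>))\<^sup>2) \<beta> \<and>
            x (Suc k) = q (x k) + aa_correction n (\<lambda>j. q (x j)) p k \<beta>)"

definition residual_diffs :: "nat \<Rightarrow> (nat \<Rightarrow> real vec) \<Rightarrow> nat \<Rightarrow> nat \<Rightarrow> real mat" where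
  "residual_diffs n r p k = mat_of_cols n (map (\<lambda>i. r k - r (k - i)) [1..<Suc p])"

end

theory Submission
  imports Defs
begin

text \<open>
  One step of Anderson acceleration is \<open>x\<^sub>k\<^sub>+\<^sub>1 = q(x\<^sub>k) + M D \<beta> = q(x\<^sub>k + D \<beta>)\<close>, where the columns
  of \<open>D\<close> are the differences \<open>x\<^sub>k - x\<^sub>k\<^sub>-\<^sub>i\<close>. The residual is affine with linear part \<open>I - M\<close>, so
  \<open>R\<^sub>k = (I - M) D\<close> and the residual of \<open>x\<^sub>k + D \<beta>\<close> is \<open>r\<^sub>k + R\<^sub>k \<beta>\<close>. The map \<open>q\<close> multiplies
  residuals by \<open>M\<close>, which gives \<open>r\<^sub>k\<^sub>+\<^sub>1 = M (r\<^sub>k + R\<^sub>k \<beta>)\<close>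
  (\<open>residual_accelerated_step\<close>, \<open>anderson_residual_step\<close>).

  The vector \<open>r\<^sub>k + R\<^sub>k \<beta>\<close> is the residual of a least-squares problem. It is the same for all
  minimizers \<open>\<beta>\<close>, namely the component of \<open>r\<^sub>k\<close> orthogonal to the range of \<open>R\<^sub>k\<close>. This component
  is \<open>(I - R\<^sub>k X) r\<^sub>k\<close> for every \<open>X\<close> such that \<open>R\<^sub>k X\<close> is a symmetric matrix with
  \<open>R\<^sub>k X R\<^sub>k = R\<^sub>k\<close>, because \<open>R\<^sub>k X\<close> is then the orthogonal projection onto that range
  (\<open>least_squares_minimizer_residual\<close>, \<open>least_squares_normal_equations\<close>). Both \<open>R\<^sub>k\<^sup>\<dagger>\<close> and, if the
  Gram matrix is invertible, \<open>(R\<^sub>k\<^sup>T R\<^sub>k)\<^sup>-\<^sup>1 R\<^sub>k\<^sup>T\<close> are such matrices \<open>X\<close>, so one argument yields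
  both formulas.

  The pseudo-inverse is given by a definite description, hence its existence and uniqueness have
  to be shown. Existence is reduced to Gauss-Jordan elimination: it provides for every
  matrix \<open>A\<close> a matrix \<open>G\<close> with \<open>A G A = A\<close>. If \<open>G\<close> has this property for \<open>A\<^sup>T A\<close>, then
  \<open>X = G A\<^sup>T\<close> satisfies the two conditions above (\<open>least_squares_inverse_of_gram\<close>). From such
  an \<open>X\<close> for \<open>A\<close> and such a \<open>Y\<close> for \<open>A\<^sup>T\<close>, the pseudo-inverse is \<open>Y\<^sup>T A X\<close>.
\<close>

section \<open>Existence and uniqueness of the pseudo-inverse\<close>

lemma real_scalar_prod_self_nonneg: "0 \<le> v \<bullet> (v :: real vec)"
  by (simp add: scalar_prod_def sum_nonneg)

lemma real_scalar_prod_self_eq_0: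
  fixes v :: "real vec"
  assumes "v \<in> carrier_vec n" and "v \<bullet> v = 0"
  shows "v = 0\<^sub>v n"
proof (rule eq_vecI)
  fix i assume "i < dim_vec (0\<^sub>v n :: real vec)"
  with assms show "v $ i = 0\<^sub>v n $ i"
    by (auto simp: scalar_prod_def sum_nonneg_eq_0_iff)
qed (use assms in auto)

text \<open>The diagonal of \<open>C\<^sup>T C\<close> holds the squared norms of the columns of \<open>C\<close>.\<close>

lemma gram_zero_imp_zero:
  fixes C :: "real mat"
  assumes C: "C \<in> carrier_mat nr nc" and zero: "transpose_mat C * C = 0\<^sub>m nc nc"
  shows "C = 0\<^sub>m nr nc"
proof (rule eq_matI)
  fix i j assume "i < dim_row (0\<^sub>m nr nc :: real mat)" "j < dim_col (0\<^sub>m nr nc :: real mat)"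
  then have ij: "i < nr" "j < nc" by auto
  have "col C j \<bullet> col C j = (transpose_mat C * C) $$ (j, j)"
    using C ij by simp
  also have "\<dots> = 0" using zero ij by simp
  finally have "col C j = 0\<^sub>v nr"
    using real_scalar_prod_self_eq_0 C ij by (metis col_carrier_vec)
  then have "col C j $ i = 0" using ij by simp
  then show "C $$ (i, j) = 0\<^sub>m nr nc $$ (i, j)" using C ij by simp
qed (use C in auto)

text \<open>
  In reduced row echelon form, the pivot columns are the first unit vectors and the rows without
  a pivot vanish. If \<open>J\<close> selects the pivot columns, \<open>C J\<close> is diagonal with ones in the nonzero
  rows of \<open>C\<close> and zeros elsewhere, so multiplication by it from the left does not change \<open>C\<close>.
\<close>

lemma row_echelon_form_generalized_inverse:
  fixes C :: "'a :: field mat"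
  assumes C: "C \<in> carrier_mat nr nc" and ech: "row_echelon_form C"
  shows "\<exists>J. J \<in> carrier_mat nc nr \<and> C * J * C = C"
proof -
  obtain f where pf: "pivot_fun C f nc"
    using ech C unfolding row_echelon_form_def by auto
  have dimC: "dim_row C = nr" using C by simp
  note piv = pivot_funD[OF dimC pf]
  \<comment> \<open>A row \<open>i\<close> without a pivot has \<open>f i = nc\<close>, which makes column \<open>i\<close> of \<open>J\<close> zero.\<close>
  define J :: "'a mat" where "J = mat nc nr (\<lambda>(j, i). if f i = j then 1 else 0)"
  have J: "J \<in> carrier_mat nc nr" by (simp add: J_def)
  have CJ: "(C * J) $$ (i, l) = (if i = l \<and> f i < nc then 1 else 0)"
    if "i < nr" "l < nr" for i l
  proof -
    have "(C * J) $$ (i, l) = (\<Sum>j = 0..<nc. C $$ (i, j) * (if f l = j then 1 else 0))"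
      using that C by (simp add: J_def scalar_prod_def)
    also have "\<dots> = (if f l < nc then C $$ (i, f l) else 0)"
      by (simp add: if_distrib[of "\<lambda>t. _ * t"] sum.delta' cong: if_cong)
    also have "\<dots> = (if i = l \<and> f i < nc then 1 else 0)"
      using piv(4)[OF that(2)] piv(5)[OF that(2) _ that(1)] by auto
    finally show ?thesis .
  qed
  have "C * J * C = C"
  proof (rule eq_matI)
    fix i j assume "i < dim_row C" "j < dim_col C"
    then have ij: "i < nr" "j < nc" using C by auto
    have "(C * J * C) $$ (i, j) = (\<Sum>l = 0..<nr. (C * J) $$ (i, l) * C $$ (l, j))"
      using ij C J by (simp add: scalar_prod_def del: assoc_mult_mat)
    also have "\<dots> = (\<Sum>l = 0..<nr. if i = l then (if f i < nc then C $$ (i, j) else 0) else 0)"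
      by (intro sum.cong) (use ij CJ in auto)
    also have "\<dots> = (if f i < nc then C $$ (i, j) else 0)"
      using ij by simp
    also have "\<dots> = C $$ (i, j)"
      using piv(1)[OF ij(1)] piv(2)[OF ij(1), of j] ij by auto
    finally show "(C * J * C) $$ (i, j) = C $$ (i, j)" .
  qed (use C J in auto)
  with J show ?thesis by blast
qed

text \<open>
  With \<open>C = P A\<close> in echelon form and \<open>C J C = C\<close>, the matrix \<open>J P\<close> works, because
  \<open>A J P A = P\<^sup>-\<^sup>1 C J C = P\<^sup>-\<^sup>1 C = A\<close>.
\<close>

lemma generalized_inverse_exists:
  fixes A :: "'a :: field mat"
  assumes A: "A \<in> carrier_mat nr nc"
  shows "\<exists>G. G \<in> carrier_mat nc nr \<and> A * G * A = A"
proof -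
  define C where "C = gauss_jordan_single A"
  note gj = gauss_jordan_single[OF A C_def[symmetric]]
  obtain P Q where PQ: "C = P * A" "P \<in> carrier_mat nr nr" "Q \<in> carrier_mat nr nr"
    "Q * P = 1\<^sub>m nr" using gj(4) by blast
  obtain J where J: "J \<in> carrier_mat nc nr" and CJC: "C * J * C = C"
    using row_echelon_form_generalized_inverse[OF gj(2,3)] by blast
  note [simp] = A J PQ(2,3) gj(2) mult_carrier_mat[OF A J] mult_carrier_mat[OF gj(2) J]
  have QC: "Q * C = A"
  proof -
    have "Q * C = Q * P * A" unfolding PQ(1) using assoc_mult_mat[OF PQ(3,2) A] by simp
    then show ?thesis using PQ(4) left_mult_one_mat[OF A] by simp
  qed
  have "A * (J * P) * A = A * J * P * A"
    using assoc_mult_mat[OF A J PQ(2)] by simp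
  also have "\<dots> = A * J * C"
    unfolding PQ(1) by (rule assoc_mult_mat[of _ nr nr _ nr _ nc]) auto
  also have "\<dots> = Q * (C * J) * C"
    unfolding QC[symmetric] by (subst assoc_mult_mat[of Q nr nr _ nc _ nr]) auto
  also have "\<dots> = Q * (C * J * C)"
    by (rule assoc_mult_mat[of _ nr nr _ nr _ nc]) auto
  finally have "A * (J * P) * A = A" unfolding CJC QC .
  moreover have "J * P \<in> carrier_mat nc nr" by (rule mult_carrier_mat[OF J PQ(2)])
  ultimately show ?thesis by blast
qed

text \<open>
  The first and third Penrose conditions. They say that \<open>A X\<close> is the orthogonal projection onto
  the range of \<open>A\<close>, so that \<open>- X v\<close> minimizes the norm of \<open>v + A \<gamma>\<close> over all \<open>\<gamma>\<close>.
\<close>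

definition is_least_squares_inverse :: "real mat \<Rightarrow> real mat \<Rightarrow> bool" where
  "is_least_squares_inverse A X \<longleftrightarrow>
     X \<in> carrier_mat (dim_col A) (dim_row A) \<and> A * X * A = A \<and> transpose_mat (A * X) = A * X"

text \<open>
  Put \<open>S = A\<^sup>T A\<close> and \<open>E = G S - I\<close>. Then \<open>S E = 0\<close>, so the Gram matrix \<open>E\<^sup>T S E\<close> of \<open>A E\<close>
  vanishes. Hence \<open>A E = 0\<close>, which is \<open>A G A\<^sup>T A = A\<close>. Although \<open>G\<close> is possibly not
  symmetric, \<open>P = A G A\<^sup>T\<close> is: \<open>P P\<^sup>T = (P A) G\<^sup>T A\<^sup>T = A G\<^sup>T A\<^sup>T = P\<^sup>T\<close>, and
  \<open>P P\<^sup>T\<close> is symmetric.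
\<close>

lemma least_squares_inverse_of_gram:
  assumes A: "A \<in> carrier_mat nr nc" and G: "G \<in> carrier_mat nc nc"
    and SGS: "transpose_mat A * A * G * (transpose_mat A * A) = transpose_mat A * A"
  shows "is_least_squares_inverse A (G * transpose_mat A)"
proof -
  let ?T = "transpose_mat A"
  define S where "S = ?T * A"
  define X where "X = G * ?T"
  have T: "?T \<in> carrier_mat nc nr" using A by simp
  have S: "S \<in> carrier_mat nc nc" unfolding S_def using A T by auto
  have X: "X \<in> carrier_mat nc nr" unfolding X_def using G T by auto
  have GS: "G * S \<in> carrier_mat nc nc" using G S by auto
  define E where "E = G * S - 1\<^sub>m nc"
  have E: "E \<in> carrier_mat nc nc" unfolding E_def using GS by auto
  have AE: "A * E = A * (G * S) - A"
    unfolding E_def using mult_minus_distrib_mat[OF A GS one_carrier_mat] A by simp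
  have SE: "S * E = 0\<^sub>m nc nc"
  proof -
    have "S * E = S * (G * S) - S"
      unfolding E_def using mult_minus_distrib_mat[OF S GS one_carrier_mat] S by simp
    also have "S * (G * S) = S"
      using SGS assoc_mult_mat[OF S G S] unfolding S_def[symmetric] by simp
    finally show ?thesis using S by auto
  qed
  have "transpose_mat (A * E) * (A * E) = transpose_mat E * (?T * (A * E))"
    using transpose_mult[OF A E] assoc_mult_mat[of "transpose_mat E" nc nc ?T nr "A * E" nc] A E T
    by auto
  also have "?T * (A * E) = S * E"
    unfolding S_def by (rule assoc_mult_mat[OF T A E, symmetric])
  finally have "transpose_mat (A * E) * (A * E) = 0\<^sub>m nc nc"
    using SE E by simp
  then have AE0: "A * (G * S) - A = 0\<^sub>m nr nc"
    using gram_zero_imp_zero[of "A * E" nr nc] mult_carrier_mat[OF A E] unfolding AE by blast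
  have AGS: "A * (G * S) = A"
  proof (rule eq_matI)
    fix i j assume ij: "i < dim_row A" "j < dim_col A"
    then have "(A * (G * S) - A) $$ (i, j) = 0" using AE0 A by auto
    then show "(A * (G * S)) $$ (i, j) = A $$ (i, j)" using ij by (simp del: index_mult_mat)
  qed (use A S in auto)
  have "A * X * A = A * (X * A)" by (rule assoc_mult_mat[OF A X A])
  also have "X * A = G * S" unfolding X_def S_def by (rule assoc_mult_mat[OF G T A])
  finally have AXA: "A * X * A = A" using AGS by simp
  define P where "P = A * X"
  have P: "P \<in> carrier_mat nr nr" unfolding P_def using A X by auto
  have PT: "transpose_mat P = A * (transpose_mat G * ?T)"
  proof -
    have "transpose_mat P = transpose_mat X * ?T"
      unfolding P_def by (rule transpose_mult[OF A X])
    also have "transpose_mat X = A * transpose_mat G"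
      unfolding X_def using transpose_mult[OF G T] by simp
    finally show ?thesis
      using assoc_mult_mat[OF A _ T, of "transpose_mat G"] G by simp
  qed
  have PPT: "P * transpose_mat P = transpose_mat P"
  proof -
    have "P * transpose_mat P = P * A * (transpose_mat G * ?T)"
      unfolding PT using assoc_mult_mat[OF P A, of "transpose_mat G * ?T" nr] G T by auto
    also have "P * A = A" using AXA unfolding P_def .
    finally show ?thesis unfolding PT .
  qed
  have "transpose_mat (P * transpose_mat P) = P * transpose_mat P"
    using transpose_mult[OF P, of "transpose_mat P" nr] P by simp
  then have "transpose_mat P = P" unfolding PPT by simp
  then show ?thesis
    using X AXA A unfolding is_least_squares_inverse_def X_def P_def by simp
qed

lemma least_squares_inverse_exists: "\<exists>X. is_least_squares_inverse A X"
proof -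
  have A: "A \<in> carrier_mat (dim_row A) (dim_col A)" by simp
  have "transpose_mat A * A \<in> carrier_mat (dim_col A) (dim_col A)" by auto
  from generalized_inverse_exists[OF this] show ?thesis
    using least_squares_inverse_of_gram[OF A] by blast
qed

text \<open>
  If \<open>Y\<close> is a least-squares inverse of \<open>A\<^sup>T\<close>, then \<open>Z = Y\<^sup>T\<close> satisfies the first and
  fourth Penrose conditions for \<open>A\<close>. For \<open>W = Z A X\<close> one has \<open>A W = A X\<close> and \<open>W A = Z A\<close>, so \<open>W\<close>
  inherits the symmetry conditions from \<open>X\<close> and \<open>Z\<close>.
\<close>

lemma is_pseudo_inverse_exists: "\<exists>X. is_pseudo_inverse A X"
proof -
  define nr nc where "nr = dim_row A" and "nc = dim_col A"
  have A: "A \<in> carrier_mat nr nc" by (simp add: nr_def nc_def)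
  obtain X where "is_least_squares_inverse A X"
    using least_squares_inverse_exists by blast
  then have X: "X \<in> carrier_mat nc nr" and AXA: "A * X * A = A"
    and AXs: "transpose_mat (A * X) = A * X"
    unfolding is_least_squares_inverse_def nr_def nc_def by auto
  obtain Y where "is_least_squares_inverse (transpose_mat A) Y"
    using least_squares_inverse_exists by blast
  then have Y: "Y \<in> carrier_mat nr nc"
    and TYT: "transpose_mat A * Y * transpose_mat A = transpose_mat A"
    and TYs: "transpose_mat (transpose_mat A * Y) = transpose_mat A * Y"
    unfolding is_least_squares_inverse_def nr_def nc_def by auto
  have T: "transpose_mat A \<in> carrier_mat nc nr" using A by simp
  define Z where "Z = transpose_mat Y"
  have Z: "Z \<in> carrier_mat nc nr" unfolding Z_def using Y by simp
  have ZA: "Z * A = transpose_mat A * Y"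
    using transpose_mult[OF T Y] TYs unfolding Z_def by simp
  have ZAs: "transpose_mat (Z * A) = Z * A" unfolding ZA by (rule TYs)
  have AZA: "A * (Z * A) = A"
  proof -
    have "transpose_mat (transpose_mat A * Y * transpose_mat A) = A * transpose_mat (transpose_mat A * Y)"
      using transpose_mult[of "transpose_mat A * Y" nc nc "transpose_mat A" nr] T Y by auto
    then show ?thesis unfolding TYT TYs ZA by simp
  qed
  define W where "W = Z * A * X"
  have ZAc: "Z * A \<in> carrier_mat nc nc" using Z A by auto
  have AXc: "A * X \<in> carrier_mat nr nr" using A X by auto
  have W: "W \<in> carrier_mat nc nr" unfolding W_def using ZAc X by auto
  have AW: "A * W = A * X"
    unfolding W_def using assoc_mult_mat[OF A ZAc X] AZA by simp
  have WA: "W * A = Z * A"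
  proof -
    have "W * A = Z * (A * X) * A" unfolding W_def using assoc_mult_mat[OF Z A X] by simp
    also have "\<dots> = Z * (A * X * A)" by (rule assoc_mult_mat[OF Z AXc A])
    finally show ?thesis unfolding AXA .
  qed
  have "W * A * W = Z * (A * W)"
    unfolding WA by (rule assoc_mult_mat[OF Z A W])
  also have "\<dots> = W"
    unfolding AW unfolding W_def by (rule assoc_mult_mat[OF Z A X, symmetric])
  finally have WAW: "W * A * W = W" .
  have "is_pseudo_inverse A W"
    unfolding is_pseudo_inverse_def AW WA
    using W WAW[unfolded WA] AXA AXs ZAs WAW nr_def nc_def by simp
  then show ?thesis by blast
qed

text \<open>
  \<open>A X\<close> and \<open>A Y\<close> are orthogonal projections onto the same range, hence equal, and likewise
  \<open>X A = Y A\<close>. Thus \<open>X = X A X = Y A X = Y A Y = Y\<close>.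
\<close>

lemma is_pseudo_inverse_unique:
  assumes "is_pseudo_inverse A X" and "is_pseudo_inverse A Y"
  shows "X = Y"
proof -
  define nr nc where "nr = dim_row A" and "nc = dim_col A"
  have A: "A \<in> carrier_mat nr nc" by (simp add: nr_def nc_def)
  have X: "X \<in> carrier_mat nc nr" "A * X * A = A" "X * A * X = X"
      "transpose_mat (A * X) = A * X" "transpose_mat (X * A) = X * A"
    and Y: "Y \<in> carrier_mat nc nr" "A * Y * A = A" "Y * A * Y = Y"
      "transpose_mat (A * Y) = A * Y" "transpose_mat (Y * A) = Y * A"
    using assms unfolding is_pseudo_inverse_def nr_def nc_def by auto
  have c: "A * X \<in> carrier_mat nr nr" "A * Y \<in> carrier_mat nr nr"
    "X * A \<in> carrier_mat nc nc" "Y * A \<in> carrier_mat nc nc" using A X(1) Y(1) by auto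
  have "A * X * (A * Y) = A * Y"
    using assoc_mult_mat[OF c(1) A Y(1)] X(2) by simp
  moreover have "A * Y * (A * X) = A * X"
    using assoc_mult_mat[OF c(2) A X(1)] Y(2) by simp
  ultimately have AXY: "A * X = A * Y"
    using transpose_mult[OF c(1,2)] X(4) Y(4) by simp
  have "X * A * (Y * A) = X * A"
    using assoc_mult_mat[OF X(1) A c(4)] assoc_mult_mat[OF A Y(1) A] Y(2) by simp
  moreover have "Y * A * (X * A) = Y * A"
    using assoc_mult_mat[OF Y(1) A c(3)] assoc_mult_mat[OF A X(1) A] X(2) by simp
  ultimately have XYA: "X * A = Y * A"
    using transpose_mult[OF c(3,4)] X(5) Y(5) by simp
  have "X = X * A * X" using X(3) by simp
  also have "\<dots> = Y * (A * X)" unfolding XYA by (rule assoc_mult_mat[OF Y(1) A X(1)])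
  also have "\<dots> = Y * A * Y" unfolding AXY by (rule assoc_mult_mat[OF Y(1) A Y(1), symmetric])
  finally show ?thesis unfolding Y(3) .
qed

lemma is_pseudo_inverse_pseudo_inverse: "is_pseudo_inverse A (pseudo_inverse A)"
  unfolding pseudo_inverse_def
  using is_pseudo_inverse_exists is_pseudo_inverse_unique by (metis theI)

lemma least_squares_inverse_pseudo_inverse: "is_least_squares_inverse A (pseudo_inverse A)"
  using is_pseudo_inverse_pseudo_inverse[of A]
  unfolding is_pseudo_inverse_def is_least_squares_inverse_def by blast

lemma invertible_mat_mat_inverse:
  fixes S :: "'a :: field mat"
  assumes S: "S \<in> carrier_mat n n" and inv: "invertible_mat S"
  shows "the (mat_inverse S) \<in> carrier_mat n n" and "S * the (mat_inverse S) = 1\<^sub>m n"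
proof -
  obtain B where "S * B = 1\<^sub>m (dim_row S)" and BS: "B * S = 1\<^sub>m (dim_row B)"
    using inv unfolding invertible_mat_def inverts_mat_def by blast
  with S have B: "S * B = 1\<^sub>m n" "B * S = 1\<^sub>m (dim_row B)" by auto
  have "dim_col (S * B) = dim_col (1\<^sub>m n :: 'a mat)" "dim_col (B * S) = dim_row B"
    using B by simp_all
  then have "B \<in> carrier_mat n n" using S by auto
  then have "S \<in> Units (ring_mat TYPE('a) n ())"
    using S B unfolding Units_def ring_mat_def by auto
  then obtain C where "mat_inverse S = Some C"
    using mat_inverse(1)[OF S, of "()"] by (cases "mat_inverse S") auto
  with mat_inverse(2)[OF S this]
  show "the (mat_inverse S) \<in> carrier_mat n n" "S * the (mat_inverse S) = 1\<^sub>m n" by auto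
qed

lemma least_squares_inverse_of_invertible_gram:
  assumes A: "A \<in> carrier_mat nr nc" and inv: "invertible_mat (transpose_mat A * A)"
  shows "is_least_squares_inverse A (the (mat_inverse (transpose_mat A * A)) * transpose_mat A)"
proof -
  have S: "transpose_mat A * A \<in> carrier_mat nc nc" using A by auto
  note G = invertible_mat_mat_inverse[OF S inv]
  show ?thesis
    by (rule least_squares_inverse_of_gram[OF A G(1)]) (use G(2) left_mult_one_mat[OF S] in simp)
qed

section \<open>Least squares\<close>

text \<open>The projection \<open>A X\<close> is symmetric, so \<open>A\<^sup>T A X = (A X A)\<^sup>T = A\<^sup>T\<close>.\<close>

lemma least_squares_normal_equations:
  assumes A: "A \<in> carrier_mat nr nc" and X: "is_least_squares_inverse A X"
    and v: "v \<in> carrier_vec nr"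
  shows "transpose_mat A *\<^sub>v ((1\<^sub>m nr - A * X) *\<^sub>v v) = 0\<^sub>v nc"
proof -
  have Xc: "X \<in> carrier_mat nc nr" and AXA: "A * X * A = A"
    and sym: "transpose_mat (A * X) = A * X"
    using X A unfolding is_least_squares_inverse_def by auto
  have T: "transpose_mat A \<in> carrier_mat nc nr" using A by simp
  have P: "A * X \<in> carrier_mat nr nr" using A Xc by auto
  have "transpose_mat A * (A * X) = transpose_mat (A * X * A)"
    using transpose_mult[OF P A] sym by simp
  then have TP: "transpose_mat A * (A * X) = transpose_mat A" unfolding AXA .
  have "transpose_mat A *\<^sub>v ((1\<^sub>m nr - A * X) *\<^sub>v v)
      = (transpose_mat A * (1\<^sub>m nr - A * X)) *\<^sub>v v"
    using assoc_mult_mat_vec[OF T _ v, of "1\<^sub>m nr - A * X"] P by (metis minus_carrier_mat)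
  also have "transpose_mat A * (1\<^sub>m nr - A * X) = 0\<^sub>m nc nr"
    using mult_minus_distrib_mat[OF T one_carrier_mat P] TP T by simp
  finally show ?thesis using v by auto
qed

text \<open>
  Write \<open>w = (I - A X) v\<close> and \<open>d = X v + \<beta>\<close>. Then \<open>v + A \<beta> = w + A d\<close>, and \<open>w\<close> is orthogonal to
  \<open>A d\<close> by the normal equations. Compared with the candidate \<open>- X v\<close>, whose residual is \<open>w\<close>, the
  minimizer \<open>\<beta>\<close> has the additional cost \<open>A d \<bullet> A d\<close>, which therefore vanishes. So \<open>A \<beta>\<close> is
  determined even when \<open>\<beta>\<close> is not.
\<close>

lemma least_squares_minimizer_residual:
  assumes A: "A \<in> carrier_mat nr nc" and X: "is_least_squares_inverse A X"
    and v: "v \<in> carrier_vec nr"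
    and min: "is_arg_min (\<lambda>\<gamma>. (norm2_vec (v + A *\<^sub>v \<gamma>))\<^sup>2) (\<lambda>\<gamma>. \<gamma> \<in> carrier_vec nc) \<beta>"
  shows "v + A *\<^sub>v \<beta> = (1\<^sub>m nr - A * X) *\<^sub>v v"
proof -
  have Xc: "X \<in> carrier_mat nc nr" using X A unfolding is_least_squares_inverse_def by auto
  have \<beta>: "\<beta> \<in> carrier_vec nc" using min unfolding is_arg_min_def by simp
  have P: "A * X \<in> carrier_mat nr nr" using A Xc by auto
  define w where "w = (1\<^sub>m nr - A * X) *\<^sub>v v"
  define d where "d = X *\<^sub>v v + \<beta>"
  have Xv: "X *\<^sub>v v \<in> carrier_vec nc" using Xc v by auto
  have d: "d \<in> carrier_vec nc" unfolding d_def using Xv \<beta> by auto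
  have weq: "w = v - A *\<^sub>v (X *\<^sub>v v)"
    unfolding w_def using minus_mult_distrib_mat_vec[OF one_carrier_mat P v] v
      assoc_mult_mat_vec[OF A Xc v] by simp
  have AXv: "A *\<^sub>v (X *\<^sub>v v) \<in> carrier_vec nr" using A Xv by auto
  have w: "w \<in> carrier_vec nr" unfolding weq using v AXv by auto
  have Ad: "A *\<^sub>v d \<in> carrier_vec nr" using A d by auto
  have split: "v + A *\<^sub>v \<beta> = w + A *\<^sub>v d"
  proof -
    have "A *\<^sub>v d = A *\<^sub>v (X *\<^sub>v v) + A *\<^sub>v \<beta>"
      unfolding d_def by (rule mult_add_distrib_mat_vec[OF A Xv \<beta>])
    moreover have "A *\<^sub>v \<beta> \<in> carrier_vec nr" using A \<beta> by auto
    ultimately show ?thesis unfolding weq using v AXv by auto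
  qed
  have orth: "w \<bullet> (A *\<^sub>v d) = 0"
    using transpose_vec_mult_scalar[OF A d w]
      least_squares_normal_equations[OF A X v, folded w_def] d by simp
  have sq: "(norm2_vec u)\<^sup>2 = u \<bullet> u" for u
    unfolding norm2_vec_def using real_scalar_prod_self_nonneg by simp
  have mXv: "- (X *\<^sub>v v) \<in> carrier_vec nc" using Xv by simp
  have at: "v + A *\<^sub>v (- (X *\<^sub>v v)) = w"
    unfolding weq using v AXv A Xc by auto
  have "(norm2_vec (v + A *\<^sub>v \<beta>))\<^sup>2 \<le> (norm2_vec (v + A *\<^sub>v (- (X *\<^sub>v v))))\<^sup>2"
    using min mXv unfolding is_arg_min_def by (meson not_less)
  then have "(w + A *\<^sub>v d) \<bullet> (w + A *\<^sub>v d) \<le> w \<bullet> w"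
    unfolding split at sq .
  moreover have "(w + A *\<^sub>v d) \<bullet> (w + A *\<^sub>v d) = w \<bullet> w + (A *\<^sub>v d) \<bullet> (A *\<^sub>v d)"
    using orth comm_scalar_prod[OF Ad w]
    by (simp add: add_scalar_prod_distrib[OF w Ad] scalar_prod_add_distrib[OF w w Ad]
        scalar_prod_add_distrib[OF Ad w Ad] w Ad)
  ultimately have "(A *\<^sub>v d) \<bullet> (A *\<^sub>v d) = 0"
    using real_scalar_prod_self_nonneg[of "A *\<^sub>v d"] by linarith
  then have "A *\<^sub>v d = 0\<^sub>v nr" using real_scalar_prod_self_eq_0[OF Ad] by simp
  then show ?thesis unfolding split using w by (simp add: w_def)
qed

section \<open>Anderson acceleration of an affine map\<close>

lemma residual_diffs_carrier: "residual_diffs n y p k \<in> carrier_mat n p"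
  unfolding residual_diffs_def by auto

lemma residual_diffs_index:
  assumes "i < n" and "j < p"
  shows "residual_diffs n y p k $$ (i, j) = (y k - y (k - Suc j)) $ i"
  using assms unfolding residual_diffs_def by (simp add: mat_of_cols_index del: upt_Suc)

lemma aa_correction_eq_mult_vec:
  assumes y: "\<And>j. y j \<in> carrier_vec n" and \<beta>: "\<beta> \<in> carrier_vec p"
  shows "aa_correction n y p k \<beta> = residual_diffs n y p k *\<^sub>v \<beta>"
proof (rule eq_vecI)
  have cl: "(\<lambda>i. \<beta> $ (i - 1) \<cdot>\<^sub>v (y k - y (k - i))) \<in> {1..p} \<rightarrow> carrier_vec n"
    using y by auto
  show "dim_vec (aa_correction n y p k \<beta>) = dim_vec (residual_diffs n y p k *\<^sub>v \<beta>)"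
    using finsum_vec_closed[OF cl] unfolding aa_correction_def residual_diffs_def by auto
  fix i assume "i < dim_vec (residual_diffs n y p k *\<^sub>v \<beta>)"
  then have i: "i < n" unfolding residual_diffs_def by simp
  have dim: "dim_vec (y j) = n" for j using y by auto
  have "aa_correction n y p k \<beta> $ i = (\<Sum>j = 1..p. \<beta> $ (j - 1) * (y k $ i - y (k - j) $ i))"
    unfolding aa_correction_def index_finsum_vec[OF finite_atLeastAtMost i cl]
    using i dim by (intro sum.cong) auto
  also have "\<dots> = (\<Sum>j = 0..<p. (y k $ i - y (k - Suc j) $ i) * \<beta> $ j)"
    by (rule sum.reindex_bij_witness[of _ Suc "\<lambda>j. j - 1"]) auto
  also have "\<dots> = (residual_diffs n y p k *\<^sub>v \<beta>) $ i"
    using i \<beta> dim residual_diffs_carrier[of n y p k]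
    by (auto simp: scalar_prod_def residual_diffs_index intro!: sum.cong)
  finally show "aa_correction n y p k \<beta> $ i = (residual_diffs n y p k *\<^sub>v \<beta>) $ i" .
qed

text \<open>Differences cancel the constant part of an affine map.\<close>

lemma residual_diffs_affine:
  assumes C: "C \<in> carrier_mat n n" and c: "c \<in> carrier_vec n"
    and y: "\<And>j. y j \<in> carrier_vec n"
  shows "residual_diffs n (\<lambda>j. C *\<^sub>v y j + c) p k = C * residual_diffs n y p k"
proof (rule eq_matI)
  fix i j assume "i < dim_row (C * residual_diffs n y p k)"
    "j < dim_col (C * residual_diffs n y p k)"
  then have ij: "i < n" "j < p" using C residual_diffs_carrier[of n y p k] by auto
  have dim: "dim_vec (y l) = n" for l using y by auto
  have "col (residual_diffs n y p k) j = y k - y (k - Suc j)"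
    using ij dim residual_diffs_carrier[of n y p k]
    by (intro eq_vecI) (auto simp: residual_diffs_index)
  then have "(C * residual_diffs n y p k) $$ (i, j) = row C i \<bullet> (y k - y (k - Suc j))"
    using ij C residual_diffs_carrier[of n y p k] by simp
  also have "\<dots> = row C i \<bullet> y k - row C i \<bullet> y (k - Suc j)"
    using C y ij by (intro scalar_prod_minus_distrib) auto
  also have "\<dots> = residual_diffs n (\<lambda>j. C *\<^sub>v y j + c) p k $$ (i, j)"
    using ij C c by (simp add: residual_diffs_index)
  finally show "residual_diffs n (\<lambda>j. C *\<^sub>v y j + c) p k $$ (i, j)
      = (C * residual_diffs n y p k) $$ (i, j)" by simp
next
  have *: "dim_col (residual_diffs n z p k) = p" "dim_row (residual_diffs n z p k) = n" for z
    using residual_diffs_carrier[of n z p k] by auto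
  show "dim_row (residual_diffs n (\<lambda>j. C *\<^sub>v y j + c) p k) = dim_row (C * residual_diffs n y p k)"
    "dim_col (residual_diffs n (\<lambda>j. C *\<^sub>v y j + c) p k) = dim_col (C * residual_diffs n y p k)"
    using C by (simp_all add: *)
qed

lemma anderson_carrier:
  assumes b: "b \<in> carrier_vec n"
    and aa: "anderson n m (fp_map M b) x"
  shows "x k \<in> carrier_vec n"
proof (cases k)
  case 0
  then show ?thesis using aa unfolding anderson_def by simp
next
  case (Suc l)
  have q: "fp_map M b y \<in> carrier_vec n" for y
    using b unfolding fp_map_def by (intro carrier_vecI) auto
  then have "aa_correction n (\<lambda>j. fp_map M b (x j)) p l \<beta> \<in> carrier_vec n" for p \<beta>
    unfolding aa_correction_def by (intro finsum_vec_closed) (simp add: Pi_def)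
  then show ?thesis using aa q unfolding Suc anderson_def Let_def by (metis add_carrier_vec)
qed

lemma residual_fp_map:
  assumes M: "M \<in> carrier_mat n n" and b: "b \<in> carrier_vec n" and y: "y \<in> carrier_vec n"
  shows "residual (fp_map M b) y = (1\<^sub>m n - M) *\<^sub>v y + - b"
proof -
  have "M *\<^sub>v y \<in> carrier_vec n" using M y by auto
  then show ?thesis
    unfolding residual_def fp_map_def minus_mult_distrib_mat_vec[OF one_carrier_mat M y]
    using M b y by (intro eq_vecI) (auto simp del: index_mult_mat_vec)
qed

text \<open>
  The accelerated point is \<open>q(y + e)\<close>, since \<open>q(y) + M e = q(y + e)\<close>, and \<open>q\<close> multiplies
  residuals by \<open>M\<close>.
\<close>

lemma residual_accelerated_step:
  assumes M: "M \<in> carrier_mat n n" and b: "b \<in> carrier_vec n"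
    and y: "y \<in> carrier_vec n" and e: "e \<in> carrier_vec n"
  shows "residual (fp_map M b) (fp_map M b y + M *\<^sub>v e)
      = M *\<^sub>v (residual (fp_map M b) y + (1\<^sub>m n - M) *\<^sub>v e)"
proof -
  let ?z = "y + e"
  have z: "?z \<in> carrier_vec n" using y e by simp
  have IM: "1\<^sub>m n - M \<in> carrier_mat n n" using M by (rule minus_carrier_mat)
  have q: "fp_map M b ?z \<in> carrier_vec n"
    using b unfolding fp_map_def by (intro carrier_vecI) auto
  have point: "fp_map M b y + M *\<^sub>v e = fp_map M b ?z"
    unfolding fp_map_def mult_add_distrib_mat_vec[OF M y e]
    using M b by (intro eq_vecI) (auto simp del: index_mult_mat_vec)
  have res: "residual (fp_map M b) y + (1\<^sub>m n - M) *\<^sub>v e = residual (fp_map M b) ?z"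
    unfolding residual_fp_map[OF M b y] residual_fp_map[OF M b z]
      mult_add_distrib_mat_vec[OF IM y e]
    using M b by (intro eq_vecI) (auto simp del: index_mult_mat_vec)
  have "M *\<^sub>v residual (fp_map M b) ?z = M *\<^sub>v ?z - M *\<^sub>v fp_map M b ?z"
    unfolding residual_def by (rule mult_minus_distrib_mat_vec[OF M z q])
  moreover have "residual (fp_map M b) (fp_map M b ?z)
      = (M *\<^sub>v ?z + b) - (M *\<^sub>v fp_map M b ?z + b)"
    unfolding residual_def by (simp add: fp_map_def)
  ultimately show ?thesis
    unfolding point res
    using M b by (intro eq_vecI) (auto simp del: index_mult_mat_vec)
qed

text \<open>
  The matrix \<open>X\<close> is left arbitrary so that the formulas with the inverse of the Gram matrix and
  with the pseudo-inverse are two instances of this one.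
\<close>

lemma anderson_residual_step:
  assumes M: "M \<in> carrier_mat n n" and b: "b \<in> carrier_vec n"
    and aa: "anderson n m (fp_map M b) x"
    and r: "\<And>j. r j = residual (fp_map M b) (x j)"
    and k: "m \<le> k"
    and X: "is_least_squares_inverse (residual_diffs n r m k) X"
  shows "r (Suc k) = M *\<^sub>v ((1\<^sub>m n - residual_diffs n r m k * X) *\<^sub>v r k)"
proof -
  let ?R = "residual_diffs n r m k"
  define D where "D = residual_diffs n x m k"
  have D: "D \<in> carrier_mat n m" unfolding D_def by (rule residual_diffs_carrier)
  have x: "x j \<in> carrier_vec n" for j using anderson_carrier[OF b aa] .
  have q: "fp_map M b (x j) \<in> carrier_vec n" for j
    using b unfolding fp_map_def by (intro carrier_vecI) auto
  have rc: "r j \<in> carrier_vec n" for j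
    unfolding r residual_def using q by (intro carrier_vecI) auto
  have IM: "1\<^sub>m n - M \<in> carrier_mat n n" using M by (rule minus_carrier_mat)
  have r_eq: "r = (\<lambda>j. residual (fp_map M b) (x j))" using r by auto
  from aa[unfolded anderson_def Let_def, folded r_eq] k
  obtain \<beta> where opt: "is_min_norm_minimizer m
               (\<lambda>\<gamma>. (norm2_vec (r k + aa_correction n r m k \<gamma>))\<^sup>2) \<beta>"
    and step: "x (Suc k) = fp_map M b (x k) + aa_correction n (\<lambda>j. fp_map M b (x j)) m k \<beta>"
    by (metis min.absorb2 r)
  have arg: "is_arg_min (\<lambda>\<gamma>. (norm2_vec (r k + aa_correction n r m k \<gamma>))\<^sup>2)
      (\<lambda>\<gamma>. \<gamma> \<in> carrier_vec m) \<beta>"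
    using opt unfolding is_min_norm_minimizer_def is_arg_min_def[of norm2_vec] by simp
  then have \<beta>: "\<beta> \<in> carrier_vec m" unfolding is_arg_min_def by simp
  have "is_arg_min (\<lambda>\<gamma>. (norm2_vec (r k + ?R *\<^sub>v \<gamma>))\<^sup>2) (\<lambda>\<gamma>. \<gamma> \<in> carrier_vec m) \<beta>"
    using arg \<beta> unfolding is_arg_min_def by (simp add: aa_correction_eq_mult_vec[OF rc])
  from least_squares_minimizer_residual[OF residual_diffs_carrier X rc this]
  have ls: "r k + ?R *\<^sub>v \<beta> = (1\<^sub>m n - ?R * X) *\<^sub>v r k" .
  have "?R = (1\<^sub>m n - M) * D"
    unfolding r_eq D_def residual_fp_map[OF M b x]
    by (rule residual_diffs_affine[OF IM _ x]) (use b in simp)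
  then have Rb: "?R *\<^sub>v \<beta> = (1\<^sub>m n - M) *\<^sub>v (D *\<^sub>v \<beta>)"
    using assoc_mult_mat_vec[OF IM D \<beta>] by simp
  have "aa_correction n (\<lambda>j. fp_map M b (x j)) m k \<beta> = (M * D) *\<^sub>v \<beta>"
    unfolding aa_correction_eq_mult_vec[of "\<lambda>j. fp_map M b (x j)", OF q \<beta>]
    unfolding D_def fp_map_def
    using residual_diffs_affine[of M n b x, OF M b x] by simp
  then have "x (Suc k) = fp_map M b (x k) + M *\<^sub>v (D *\<^sub>v \<beta>)"
    using step assoc_mult_mat_vec[OF M D \<beta>] by simp
  then have "r (Suc k) = M *\<^sub>v (r k + ?R *\<^sub>v \<beta>)"
    unfolding r[of "Suc k"] r[of k] Rb
    using residual_accelerated_step[OF M b x, of "D *\<^sub>v \<beta>" k] D \<beta> by simp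
  then show ?thesis unfolding ls .
qed

theorem proposition2p7:
  fixes n m :: nat and M :: "real mat" and b :: "real vec"
    and x r :: "nat \<Rightarrow> real vec" and R :: "nat \<Rightarrow> real mat"
  assumes "M \<in> carrier_mat n n" and "b \<in> carrier_vec n"
    and "invertible_mat (1\<^sub>m n - M)" and "M \<noteq> 0\<^sub>m n n"
    and "m \<ge> 1"
    and "anderson n m (fp_map M b) x"
    and "\<And>k. r k = residual (fp_map M b) (x k)"
    and "\<And>k. k \<ge> m \<Longrightarrow> R k = residual_diffs n r m k"
  shows "\<forall>k\<ge>m.
      (invertible_mat (transpose_mat (R k) * R k) \<longrightarrow>
         r (Suc k) = M *\<^sub>v ((1\<^sub>m n - R k * the (mat_inverse (transpose_mat (R k) * R k))
                                   * transpose_mat (R k)) *\<^sub>v r k)) \<and>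
      r (Suc k) = M *\<^sub>v ((1\<^sub>m n - R k * pseudo_inverse (R k)) *\<^sub>v r k) \<and>
      transpose_mat (R k) *\<^sub>v ((1\<^sub>m n - R k * pseudo_inverse (R k)) *\<^sub>v r k) = 0\<^sub>v m"
proof (intro allI impI conjI)
  fix k assume k: "m \<le> k"
  note Rk = assms(8)[OF k]
  have Rc: "R k \<in> carrier_mat n m" unfolding Rk by (rule residual_diffs_carrier)
  note step = anderson_residual_step[OF assms(1,2,6,7) k, folded Rk]
  note pinv = least_squares_inverse_pseudo_inverse[of "R k"]
  show "r (Suc k) = M *\<^sub>v ((1\<^sub>m n - R k * pseudo_inverse (R k)) *\<^sub>v r k)"
    by (rule step[OF pinv])
  have "r k \<in> carrier_vec n"
    unfolding assms(7) residual_def fp_map_def using assms(2) by (intro carrier_vecI) auto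
  then show "transpose_mat (R k) *\<^sub>v ((1\<^sub>m n - R k * pseudo_inverse (R k)) *\<^sub>v r k) = 0\<^sub>v m"
    by (rule least_squares_normal_equations[OF Rc pinv])
  assume inv: "invertible_mat (transpose_mat (R k) * R k)"
  have S: "transpose_mat (R k) * R k \<in> carrier_mat m m" using Rc by auto
  have "R k * the (mat_inverse (transpose_mat (R k) * R k)) * transpose_mat (R k)
      = R k * (the (mat_inverse (transpose_mat (R k) * R k)) * transpose_mat (R k))"
    using assoc_mult_mat[OF Rc invertible_mat_mat_inverse(1)[OF S inv], of "transpose_mat (R k)" n] Rc
    by simp
  then show "r (Suc k) = M *\<^sub>v ((1\<^sub>m n - R k * the (mat_inverse (transpose_mat (R k) * R k))
                                   * transpose_mat (R k)) *\<^sub>v r k)"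
    using step[OF least_squares_inverse_of_invertible_gram[OF Rc inv]] by simp
qed

end
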